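(* Let $A\in\mathbb{R}^{n\times n}$, $B\in\mathbb{R}^{n\times m}$, $C\in\mathbb{R}^{p\times n}$, let $1\le r\le n-1$, and assume $|\lambda_r[A]|>|\lambda_{r+1}[A]|$. Suppose that the discrete-time linear time-invariant system $x[k+1]=Ax[k]+Bu[k]$, $y[k]=Cx[k]$ is reachable and observable. Let $\bar U_r\in\mathcal{U}_r^{\rm (d)}[A]$ and $\bar V_r\in\mathcal{U}_r^{\rm (d)}[A^{\top}]$. Then the two $r$-dimensional reduced models with system matrices $$\big(A_{\bar U_r},\ B_{\bar V_r(\bar V_r^{\top}\bar U_r)^{-\top}},\ C_{\bar U_r}\big)\quad\text{and}\quad\big(A_{\bar V_r},\ B_{\bar V_r},\ C_{\bar U_r(\bar V_r^{\top}\bar U_r)^{-1}}\big)$$ are both observable and reachable. Moreover, they share the same transfer function: $$C_{\bar U_r}(zI_r-A_{\bar U_r})^{-1}B_{\bar V_r(\bar V_r^{\top}\bar U_r)^{-\top}}=C_{\bar U_r(\bar V_r^{\top}\bar U_r)^{-1}}(zI_r-A_{\bar V_r})^{-1}B_{\bar V_r}.$$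
   Context: $\mathrm{St}(r,n):=\{X\in\mathbb{R}^{n\times r}\mid X^{\top}X=I_r\}$. The eigenvalues of a square matrix $M\in\mathbb{R}^{n\times n}$ (with algebraic multiplicity) are ordered so that $|\lambda_1[M]|\ge\dots\ge|\lambda_n[M]|$. $\psi_i[M]$ denotes the corresponding normalized right (generalized) eigenvector and $\Psi[M]:=[\psi_1[M],\dots,\psi_n[M]]$, a non-singular matrix whose columns form Jordan chains of $M$, so that $\Psi[M]^{-1}M\Psi[M]$ is block diagonal. For $M\in\mathbb{R}^{n\times n}$ with $|\lambda_r[M]|>|\lambda_{r+1}[M]|$, $$\mathcal{U}_r^{\rm (d)}[M]:=\left\{\Psi[M]\begin{bmatrix}K_r\\0_{n-r,r}\end{bmatrix}\in\mathrm{St}(r,n)\ \middle|\ K_r\in\mathbb{C}^{r\times r},\ \mathrm{rank}(K_r)=r\right\},$$ i.e. the real matrices with orthonormal columns spanning the sum of the generalized eigenspaces of $M$ for its $r$ eigenvalues of largest absolute value. For a real matrix $Y$ with $n$ rows: $A_Y:=Y^{\top}AY$, $B_Y:=Y^{\top}B$, $C_Y:=CY$. $X^{-\top}:=(X^{-1})^{\top}$; thus $B_{\bar V_r(\bar V_r^{\top}\bar U_r)^{-\top}}=(\bar V_r^{\top}\bar U_r)^{-1}\bar V_r^{\top}B$ and $C_{\bar U_r(\bar V_r^{\top}\bar U_r)^{-1}}=C\bar U_r(\bar V_r^{\top}\bar U_r)^{-1}$. Under the stated assumptions the matrix $\bar V_r^{\top}\bar U_r$ is non-singular, so these expressions are well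 defined. Reachability and observability are the usual notions: a model $(A,B,C)$ of state dimension $n$ is reachable if $[B,AB,\dots,A^{n-1}B]$ has rank $n$, and observable if $[C^{\top},A^{\top}C^{\top},\dots,(A^{\top})^{n-1}C^{\top}]$ has rank $n$. *)

theory Defs
  imports
    "Jordan_Normal_Form.Char_Poly"
    "Jordan_Normal_Form.Conjugate"
    "Jordan_Normal_Form.DL_Rank"
    "Jordan_Normal_Form.Gauss_Jordan_Elimination"
begin

abbreviation cmat :: "real mat \<Rightarrow> complex mat" where
  "cmat \<equiv> map_mat complex_of_real"

(* Only meaningful for non-singular square matrices. *)
definition minv :: "'a :: field mat \<Rightarrow> 'a mat" where
  "minv M = the (mat_inverse M)"

definition stiefel :: "nat \<Rightarrow> nat \<Rightarrow> real mat set" where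
  "stiefel r n = {X \<in> carrier_mat n r. transpose_mat X * X = 1\<^sub>m r}"

(* All complex eigenvalues with algebraic multiplicity, by decreasing absolute value.
   The list is determined only up to reordering of entries with equal absolute value, so it is
   a relation. Lists count from 0: the i-th eigenvalue is lam ! (i - 1). *)
definition ordered_eigvals :: "real mat \<Rightarrow> complex list \<Rightarrow> bool" where
  "ordered_eigvals M lam \<longleftrightarrow>
     char_poly (cmat M) = (\<Prod>a\<leftarrow>lam. [:- a, 1:]) \<and>
     sorted_wrt (\<lambda>a b. cmod b \<le> cmod a) lam"

(* The columns of Psi are unit vectors forming Jordan chains: each one is either an eigenvector
   (the head of a chain) or the successor of the column to its left. Since the generalized
   eigenvectors are normalized as well, the coupling coefficient c need not be 1. *)
definition ordered_eigvec_matrix :: "real mat \<Rightarrow> complex list \<Rightarrow> complex mat \<Rightarrow> bool" where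
  "ordered_eigvec_matrix M lam Psi \<longleftrightarrow>
     Psi \<in> carrier_mat (dim_row M) (dim_row M) \<and> invertible_mat Psi \<and>
     (\<forall>j < dim_row M.
        col Psi j \<bullet>c col Psi j = 1 \<and>
        (cmat M *\<^sub>v col Psi j = (lam ! j) \<cdot>\<^sub>v col Psi j \<or>
         (0 < j \<and> lam ! (j - 1) = lam ! j \<and>
          (\<exists>c. c \<noteq> 0 \<and>
             cmat M *\<^sub>v col Psi j = (lam ! j) \<cdot>\<^sub>v col Psi j + c \<cdot>\<^sub>v col Psi (j - 1)))))"

(* Psi is not unique; every admissible choice is allowed. If the r-th and (r+1)-th eigenvalues
   have different absolute values, all choices give the same set. *)
definition U_d :: "nat \<Rightarrow> real mat \<Rightarrow> real mat set" where
  "U_d r M = {X \<in> stiefel r (dim_row M). \<exists>lam Psi K.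
     ordered_eigvals M lam \<and> ordered_eigvec_matrix M lam Psi \<and>
     K \<in> carrier_mat r r \<and> vec_space.rank r K = r \<and>
     cmat X = Psi * (K @\<^sub>r 0\<^sub>m (dim_row M - r) r)}"

definition red_A :: "real mat \<Rightarrow> real mat \<Rightarrow> real mat" where
  "red_A Y A = transpose_mat Y * A * Y"

definition red_B :: "real mat \<Rightarrow> real mat \<Rightarrow> real mat" where
  "red_B Y B = transpose_mat Y * B"

definition red_C :: "real mat \<Rightarrow> real mat \<Rightarrow> real mat" where
  "red_C Y C = C * Y"

(* The block matrix [B, A B, ..., A^(n-1) B]: column k * m + l is column l of A^k B. *)
definition reach_mat :: "real mat \<Rightarrow> real mat \<Rightarrow> real mat" where
  "reach_mat A B = (let n = dim_row A; m = dim_col B in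
     mat n (n * m) (\<lambda>(i, j). ((A ^\<^sub>m (j div m)) * B) $$ (i, j mod m)))"

definition reachable :: "real mat \<Rightarrow> real mat \<Rightarrow> bool" where
  "reachable A B \<longleftrightarrow> vec_space.rank (dim_row A) (reach_mat A B) = dim_row A"

definition observable :: "real mat \<Rightarrow> real mat \<Rightarrow> bool" where
  "observable A C \<longleftrightarrow>
     vec_space.rank (dim_row A) (reach_mat (transpose_mat A) (transpose_mat C)) = dim_row A"

(* z I - A *)
definition pencil :: "real mat \<Rightarrow> complex \<Rightarrow> complex mat" where
  "pencil A z = z \<cdot>\<^sub>m 1\<^sub>m (dim_row A) - cmat A"

(* Only meaningful at points z where the pencil is non-singular. *)
definition transfer_fun :: "real mat \<Rightarrow> real mat \<Rightarrow> real mat \<Rightarrow> complex \<Rightarrow> complex mat" where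
  "transfer_fun A B C z = cmat C * minv (pencil A z) * cmat B"

end

theory Submission
  imports Defs
begin

text \<open>
  A Jordan chain matrix \<open>\<Psi>\<close> of \<open>A\<close> and one, \<open>\<Phi>\<close>, of the transpose of \<open>A\<close> satisfy
  \<open>\<Phi>\<^sub>i \<bullet> \<Psi>\<^sub>j = 0\<close> for \<open>i \<le> r < j\<close>: the two eigenvalues differ in absolute value, and one inducts along the
  chains. Hence the matrix of all pairings, which is invertible, is block lower triangular, so its leading
  \<open>r \<times> r\<close> block is invertible, and with it \<open>T = V\<^sup>T U\<close>. By invariance, \<open>A U = U A\<^sub>U\<close> and
  \<open>V\<^sup>T A = A\<^sub>V V\<^sup>T\<close>, so \<open>A\<^sub>V T = T A\<^sub>U\<close>, and \<open>T\<close> is a similarity between the two reduced models.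
  Reachability passes from \<open>(A, B)\<close> to \<open>(A', S B)\<close> whenever \<open>A' S = S A\<close> and \<open>S\<close> has a right inverse; by duality
  this covers the four reachability and observability claims.
\<close>

subsection \<open>Inverses and rank\<close>

text \<open>\<open>invertible_mat\<close> yields a two-sided inverse of unspecified dimensions.
  Comparing dimensions places it among the n by n matrices, so \<open>mat_inverse\<close> cannot
  return \<open>None\<close> and the \<open>the\<close> in \<open>minv\<close> is
  meaningful.\<close>

lemma inverts_mat_minv:
  fixes M :: "'a :: field mat"
  assumes M: "M \<in> carrier_mat n n" and "invertible_mat M"
  shows "minv M \<in> carrier_mat n n" "M * minv M = 1\<^sub>m n" "minv M * M = 1\<^sub>m n"
proof -
  obtain N where N: "M * N = 1\<^sub>m (dim_row M)" "N * M = 1\<^sub>m (dim_row N)"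
    using assms unfolding invertible_mat_def inverts_mat_def by blast
  have "dim_col N = n"
    using arg_cong[OF N(1), of dim_col] M by simp
  moreover have "dim_row N = n"
    using arg_cong[OF N(2), of dim_col] M by simp
  ultimately have "M \<in> Units (ring_mat TYPE('a) n ())"
    using M N unfolding Units_def ring_mat_def by auto
  then obtain X where X: "mat_inverse M = Some X"
    using mat_inverse(1)[OF M] by fastforce
  then show "minv M \<in> carrier_mat n n" "M * minv M = 1\<^sub>m n" "minv M * M = 1\<^sub>m n"
    using mat_inverse(2)[OF M X] unfolding minv_def by auto
qed

lemma invertible_mat_if_right_inverse:
  fixes M :: "'a :: field mat"
  assumes "M \<in> carrier_mat n n" "N \<in> carrier_mat n n" "M * N = 1\<^sub>m n"
  shows "invertible_mat M"
  using assms mat_mult_left_right_inverse[OF assms]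
  unfolding invertible_mat_def inverts_mat_def square_mat.simps by auto

lemma invertible_mat_iff_det:
  fixes M :: "'a :: field mat"
  assumes M: "M \<in> carrier_mat n n"
  shows "invertible_mat M \<longleftrightarrow> det M \<noteq> 0"
proof
  assume "invertible_mat M"
  then show "det M \<noteq> 0"
    using inverts_mat_minv[OF M] det_mult[OF M, of "minv M"] by auto
next
  assume "det M \<noteq> 0"
  from det_non_zero_imp_unit[OF M this, of "()"]
  obtain N where "N \<in> carrier_mat n n" "M * N = 1\<^sub>m n"
    unfolding Units_def ring_mat_def by auto
  with M show "invertible_mat M"
    by (rule invertible_mat_if_right_inverse)
qed

lemma minv_eqI:
  fixes M :: "'a :: field mat"
  assumes M: "M \<in> carrier_mat n n" and N: "N \<in> carrier_mat n n" and MN: "M * N = 1\<^sub>m n"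
  shows "minv M = N"
proof -
  have inv: "invertible_mat M"
    using assms by (rule invertible_mat_if_right_inverse)
  note minv = inverts_mat_minv[OF M inv]
  have "minv M = minv M * (M * N)"
    using minv MN by simp
  also have "\<dots> = N"
    using minv M N by (simp flip: assoc_mult_mat)
  finally show ?thesis .
qed

section \<open>Full row rank over the reals as a kernel condition\<close>

lemma real_scalar_prod_self_eq_0:
  fixes x :: "real vec"
  assumes "x \<in> carrier_vec n" "x \<bullet> x = 0"
  shows "x = 0\<^sub>v n"
proof -
  have "\<forall>i\<in>{0..<n}. x $ i * x $ i = 0"
    using assms unfolding scalar_prod_def by (subst sum_nonneg_eq_0_iff[symmetric]) auto
  then show ?thesis
    using assms by (intro eq_vecI) auto
qed

text \<open>The rank is the size of a maximal independent set of columns, and n independent vectors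
  in dimension n form a basis. Conversely, if the columns span the whole space, the rank is its
  dimension.\<close>

lemma (in vec_space) rank_eq_iff_col_space_eq:
  assumes M: "M \<in> carrier_mat n nc"
  shows "rank M = n \<longleftrightarrow> col_space M = carrier_vec n"
proof -
  let ?S = "set (cols M)"
  have S: "?S \<subseteq> carrier_vec n"
    using cols_dim M by blast
  obtain U where U: "maximal U (\<lambda>T. T \<subseteq> ?S \<and> lin_indpt T)"
    using maximal_exists[of "\<lambda>T. T \<subseteq> ?S \<and> lin_indpt T" "card ?S" "{}"]
    by (meson List.finite_set card_mono empty_iff empty_subsetI finite_lin_indpt2 rev_finite_subset)
  then have U': "U \<subseteq> ?S" "lin_indpt U" "finite U"
    unfolding maximal_def using finite_subset by auto
  have r: "rank M = card U"
    by (rule rank_card_indpt[OF M U])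
  show ?thesis
  proof
    assume "rank M = n"
    then have "basis U"
      using U' S r dim_is_n by (intro dim_li_is_basis) auto
    then have "span U = carrier_vec n"
      unfolding basis_def by simp
    moreover have "span U \<subseteq> span ?S"
      using span_is_monotone U' by blast
    moreover have "span ?S \<subseteq> carrier_vec n"
      using span_is_subset2[of ?S] S by simp
    ultimately show "col_space M = carrier_vec n"
      unfolding col_space_def by blast
  next
    assume "col_space M = carrier_vec n"
    then have "span ?S = carrier V"
      unfolding col_space_def by simp
    then have "span_vs ?S = V"
      by simp
    then show "rank M = n"
      unfolding rank_def using dim_is_n by simp
  qed
qed

text \<open>The kernel of the transpose is the orthogonal complement of the column space, and a real
  vector orthogonal to itself is zero. This replaces the rank in the definitions of reachability and
  observability by a condition on vectors.\<close>

lemma rank_real_eq_iff_kernel_transpose: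
  fixes M :: "real mat"
  assumes M: "M \<in> carrier_mat n nc"
  shows "vec_space.rank n M = n \<longleftrightarrow>
    (\<forall>x \<in> carrier_vec n. transpose_mat M *\<^sub>v x = 0\<^sub>v nc \<longrightarrow> x = 0\<^sub>v n)"
proof -
  interpret vec_space "TYPE(real)" n .
  note cs = rank_eq_iff_col_space_eq[OF M] col_space_eq[OF M]
  show ?thesis
  proof (intro iffI ballI impI)
    fix x :: "real vec"
    assume "rank M = n" and x: "x \<in> carrier_vec n" and 0: "transpose_mat M *\<^sub>v x = 0\<^sub>v nc"
    then have "x \<in> col_space M"
      using cs by simp
    then obtain y where y: "y \<in> carrier_vec nc" "M *\<^sub>v y = x"
      unfolding cs using M by auto
    have "x \<bullet> x = (transpose_mat M *\<^sub>v x) \<bullet> y"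
      using transpose_vec_mult_scalar[OF M y(1) x] y by simp
    also have "\<dots> = 0"
      using y 0 by simp
    finally show "x = 0\<^sub>v n"
      using x by (intro real_scalar_prod_self_eq_0)
  next
    assume ker: "\<forall>x \<in> carrier_vec n. transpose_mat M *\<^sub>v x = 0\<^sub>v nc \<longrightarrow> x = 0\<^sub>v n"
    txt \<open>Over the reals, the Gram matrix has the same kernel as the transpose, which gives \<open>M\<close> a right inverse.\<close>
    let ?G = "M * transpose_mat M"
    have G: "?G \<in> carrier_mat n n"
      using M by simp
    have "det ?G \<noteq> 0"
    proof
      assume "det ?G = 0"
      then obtain x where x: "x \<in> carrier_vec n" "x \<noteq> 0\<^sub>v n" "?G *\<^sub>v x = 0\<^sub>v n"
        using det_0_iff_vec_prod_zero_field[OF G] by auto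
      let ?y = "transpose_mat M *\<^sub>v x"
      have y: "?y \<in> carrier_vec nc"
        using M x by auto
      have "M *\<^sub>v ?y = 0\<^sub>v n"
        using x M by (subst assoc_mult_mat_vec[symmetric, of _ n nc _ n]) auto
      then have "?y \<bullet> ?y = 0"
        using transpose_vec_mult_scalar[OF M y x(1)] x by simp
      then show False
        using real_scalar_prod_self_eq_0[OF y] ker x by auto
    qed
    then have "invertible_mat ?G"
      using invertible_mat_iff_det[OF G] by simp
    note N = inverts_mat_minv[OF G this]
    have "col_space M = carrier_vec n"
    proof -
      have "\<exists>y \<in> carrier_vec nc. M *\<^sub>v y = x" if x: "x \<in> carrier_vec n" for x
      proof
        let ?y = "transpose_mat M *\<^sub>v (minv ?G *\<^sub>v x)"
        show "?y \<in> carrier_vec nc"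
          using M N(1) x by (intro mult_mat_vec_carrier[of _ _ n]) auto
        have "M *\<^sub>v ?y = ?G *\<^sub>v (minv ?G *\<^sub>v x)"
          using M N(1) x by (subst assoc_mult_mat_vec[of _ n nc _ n]) auto
        also have "\<dots> = x"
          using M G N x by (subst assoc_mult_mat_vec[symmetric, of _ n n _ n]) auto
        finally show "M *\<^sub>v ?y = x" .
      qed
      then show ?thesis
        unfolding cs using M by auto
    qed
    then show "rank M = n"
      using cs by simp
  qed
qed

subsection \<open>The Cayley-Hamilton theorem and reachability\<close>

text \<open>Comparing the coefficients of \<open>(xI - A) adj(xI - A) = \<chi>(x) I\<close> and multiplying the \<open>k\<close>-th equation by
  \<open>A\<^sup>k\<close> makes the sum telescope; \<open>Q k\<close> below is the \<open>k\<close>-th coefficient of the adjugate.\<close>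

lemma cayley_hamilton_index:
  fixes A :: "'a :: comm_ring_1 mat"
  assumes A: "A \<in> carrier_mat n n" and i: "i < n" and j: "j < n"
  shows "(\<Sum>k\<le>n. coeff (char_poly A) k * (A ^\<^sub>m k) $$ (i, j)) = 0"
proof -
  let ?P = "char_poly_matrix A"
  define Q where "Q k = map_mat (\<lambda>p. coeff p k) (adj_mat ?P)" for k
  let ?c = "coeff (char_poly A)"
  have P: "?P \<in> carrier_mat n n"
    using A by simp
  note adj = adj_mat[OF P]
  have Q[simp]: "Q k \<in> carrier_mat n n" for k
    using adj unfolding Q_def by simp
  have Q_dim[simp]: "dim_row (Q k) = n" "dim_col (Q k) = n" for k
    using Q[of k] by (simp_all del: Q)
  have eq: "coeff (\<Sum>l<n. ?P $$ (a, l) * adj_mat ?P $$ (l, b)) k = (if a = b then ?c k else 0)"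
    if "a < n" "b < n" for a b k
  proof -
    have "(\<Sum>l<n. ?P $$ (a, l) * adj_mat ?P $$ (l, b)) = (?P * adj_mat ?P) $$ (a, b)"
      using P adj(1) that by (simp add: scalar_prod_def atLeast0LessThan)
    also have "\<dots> = (if a = b then char_poly A else 0)"
      unfolding adj using that by (simp add: char_poly_def)
    finally show ?thesis
      by simp
  qed
  \<comment> \<open>Splits xI - A into its two summands: multiplication by x is
    \<open>pCons 0\<close> and occurs on the diagonal only, while A contributes constant
    polynomials.\<close>
  have entry: "?P $$ (a, l) * adj_mat ?P $$ (l, b) =
      (if a = l then pCons 0 (adj_mat ?P $$ (a, b)) else 0) - [:A $$ (a, l):] * adj_mat ?P $$ (l, b)"
    if "a < n" "b < n" "l < n" for a b l
    using that A by (auto simp: char_poly_matrix_def algebra_simps)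
  have entry_sum: "(\<Sum>l<n. ?P $$ (a, l) * adj_mat ?P $$ (l, b)) =
      pCons 0 (adj_mat ?P $$ (a, b)) - (\<Sum>l<n. [:A $$ (a, l):] * adj_mat ?P $$ (l, b))"
    if "a < n" "b < n" for a b
    using that by (simp add: entry sum_subtractf sum.delta cong: sum.cong_simp)
  have AQ: "(A * Q k) $$ (a, b) = (\<Sum>l<n. A $$ (a, l) * coeff (adj_mat ?P $$ (l, b)) k)"
    if "a < n" "b < n" for a b k
    using that A adj(1) by (simp add: Q_def scalar_prod_def atLeast0LessThan)
  have step: "Q k = A * Q (Suc k) + ?c (Suc k) \<cdot>\<^sub>m 1\<^sub>m n" for k
  proof (rule eq_matI)
    fix a b assume "a < dim_row (A * Q (Suc k) + ?c (Suc k) \<cdot>\<^sub>m 1\<^sub>m n)"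
      "b < dim_col (A * Q (Suc k) + ?c (Suc k) \<cdot>\<^sub>m 1\<^sub>m n)"
    then have ab: "a < n" "b < n" by auto
    show "Q k $$ (a, b) = (A * Q (Suc k) + ?c (Suc k) \<cdot>\<^sub>m 1\<^sub>m n) $$ (a, b)"
      using eq[OF ab, of "Suc k"] ab A AQ[OF ab, of "Suc k"] adj(1)
      unfolding entry_sum[OF ab] by (simp add: coeff_sum Q_def algebra_simps)
  qed (use A in simp_all)
  \<comment> \<open>The constant coefficient receives no contribution from xI, hence the zero matrix
    in the place where \<open>step\<close> has \<open>Q k\<close>.\<close>
  have base: "0\<^sub>m n n = A * Q 0 + ?c 0 \<cdot>\<^sub>m 1\<^sub>m n"
  proof (rule eq_matI)
    fix a b assume "a < dim_row (A * Q 0 + ?c 0 \<cdot>\<^sub>m 1\<^sub>m n)" "b < dim_col (A * Q 0 + ?c 0 \<cdot>\<^sub>m 1\<^sub>m n)"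
    then have ab: "a < n" "b < n" by auto
    show "0\<^sub>m n n $$ (a, b) = (A * Q 0 + ?c 0 \<cdot>\<^sub>m 1\<^sub>m n) $$ (a, b)"
      using eq[OF ab, of 0] ab A AQ[OF ab, of 0]
      unfolding entry_sum[OF ab] by (auto simp: coeff_sum neg_eq_iff_add_eq_0 add.commute)
  qed (use A in simp_all)
  have pow: "A ^\<^sub>m k * (A * Q l + c \<cdot>\<^sub>m 1\<^sub>m n) = A ^\<^sub>m Suc k * Q l + c \<cdot>\<^sub>m A ^\<^sub>m k" for k l c
    using A by (simp add: mult_add_distrib_mat[of _ n n _ n] mult_smult_distrib[of _ n n _ n]
        assoc_mult_mat[of _ n n _ n _ n])
  \<comment> \<open>Only the boundary term of the telescoping sum remains; \<open>base\<close>
    starts the sum and \<open>step\<close> extends it.\<close>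
  have tele: "(\<Sum>k\<le>N. ?c k * (A ^\<^sub>m k) $$ (i, j)) = - (A ^\<^sub>m Suc N * Q N) $$ (i, j)" for N
  proof (induction N)
    case 0
    have "0\<^sub>m n n = A ^\<^sub>m Suc 0 * Q 0 + ?c 0 \<cdot>\<^sub>m A ^\<^sub>m 0"
      unfolding pow[symmetric] base[symmetric] using A by simp
    from arg_cong[OF this, of "\<lambda>M. M $$ (i, j)"] show ?case
      using i j A by (simp add: add_eq_0_iff2)
  next
    case (Suc N)
    have "A ^\<^sub>m Suc N * Q N = A ^\<^sub>m Suc (Suc N) * Q (Suc N) + ?c (Suc N) \<cdot>\<^sub>m A ^\<^sub>m Suc N"
      unfolding pow[symmetric] step[symmetric] by simp
    from arg_cong[OF this, of "\<lambda>M. M $$ (i, j)"] show ?case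
      using Suc i j A Q[of "Suc N"] by (simp del: pow_mat.simps)
  qed
  \<comment> \<open>N exceeds the degree of every entry of the adjugate, so \<open>Q N\<close> and
    with it the boundary term vanish. N is also at least n, the degree of the characteristic
    polynomial, so the sums up to N and up to n agree.\<close>
  define N where "N = n + Max (insert 0 {degree (adj_mat ?P $$ (a, b)) + 1 | a b. a < n \<and> b < n})"
  have fin: "finite {degree (adj_mat ?P $$ (a, b)) + 1 | a b. a < n \<and> b < n}"
    by (rule finite_image_set2) auto
  have "Q N = 0\<^sub>m n n"
  proof (rule eq_matI)
    fix a b assume "a < dim_row (0\<^sub>m n n :: 'a mat)" "b < dim_col (0\<^sub>m n n :: 'a mat)"
    then have ab: "a < n" "b < n" by auto
    have "degree (adj_mat ?P $$ (a, b)) + 1 \<le> Max (insert 0 {degree (adj_mat ?P $$ (a, b)) + 1 | a b. a < n \<and> b < n})"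
      using ab fin by (intro Max_ge) auto
    then have "degree (adj_mat ?P $$ (a, b)) < N"
      unfolding N_def by linarith
    then show "Q N $$ (a, b) = 0\<^sub>m n n $$ (a, b)"
      using ab adj(1) by (simp add: Q_def coeff_eq_0)
  qed auto
  then have "(\<Sum>k\<le>N. ?c k * (A ^\<^sub>m k) $$ (i, j)) = 0"
    unfolding tele using A i j by (simp del: pow_mat.simps)
  moreover have "(\<Sum>k\<le>N. ?c k * (A ^\<^sub>m k) $$ (i, j)) = (\<Sum>k\<le>n. ?c k * (A ^\<^sub>m k) $$ (i, j))"
    using degree_monic_char_poly[OF A]
    by (intro sum.mono_neutral_right) (auto simp: N_def coeff_eq_0)
  ultimately show ?thesis
    by simp
qed

text \<open>The entrywise identities are summed with weights \<open>x $ a * v $ b\<close>. In this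
  form the theorem applies directly to the pairing of a fixed vector with the columns of the blocks
  of the reachability matrix.\<close>

lemma cayley_hamilton_bilinear:
  fixes A :: "'a :: comm_ring_1 mat"
  assumes A: "A \<in> carrier_mat n n" and x: "x \<in> carrier_vec n" and v: "v \<in> carrier_vec n"
  shows "(\<Sum>k\<le>n. coeff (char_poly A) k * (x \<bullet> (A ^\<^sub>m k *\<^sub>v v))) = 0"
proof -
  have "x \<bullet> (A ^\<^sub>m k *\<^sub>v v) = (\<Sum>a<n. \<Sum>b<n. x $ a * v $ b * (A ^\<^sub>m k) $$ (a, b))" for k
    using A pow_carrier_mat[OF A, of k] x v
    by (simp add: scalar_prod_def atLeast0LessThan sum_distrib_left ac_simps cong: sum.cong_simp)
  then have "(\<Sum>k\<le>n. coeff (char_poly A) k * (x \<bullet> (A ^\<^sub>m k *\<^sub>v v))) =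
      (\<Sum>k\<le>n. \<Sum>a<n. \<Sum>b<n. x $ a * v $ b * (coeff (char_poly A) k * (A ^\<^sub>m k) $$ (a, b)))"
    by (simp add: sum_distrib_left ac_simps)
  also have "\<dots> = (\<Sum>a<n. \<Sum>b<n. x $ a * v $ b * (\<Sum>k\<le>n. coeff (char_poly A) k * (A ^\<^sub>m k) $$ (a, b)))"
    by (simp add: sum_distrib_left sum.swap[of _ _ "{..n}"])
  also have "\<dots> = 0"
    by (simp add: cayley_hamilton_index[OF A])
  finally show ?thesis .
qed

section \<open>Reachability as a kernel condition on all powers\<close>

lemma pow_mat_add:
  assumes A: "A \<in> carrier_mat n n"
  shows "A ^\<^sub>m (j + k) = A ^\<^sub>m j * A ^\<^sub>m k"
  using A by (induction k) (simp_all add: assoc_mult_mat[of _ n n _ n _ n])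

lemma reach_mat_carrier:
  assumes "A \<in> carrier_mat n n" "B \<in> carrier_mat n m"
  shows "reach_mat A B \<in> carrier_mat n (n * m)"
  using assms by (simp add: reach_mat_def Let_def)

text \<open>The map from j to \<open>(j div m, j mod m)\<close> is a bijection between the column
  indices and the pairs of a block k < n and a column l < m in it, so the kernel condition decouples
  into the blocks.\<close>

lemma transpose_reach_mat_mult_eq_0_iff:
  assumes A: "A \<in> carrier_mat n n" and B: "B \<in> carrier_mat n m" and x: "x \<in> carrier_vec n"
  shows "transpose_mat (reach_mat A B) *\<^sub>v x = 0\<^sub>v (n * m) \<longleftrightarrow>
    (\<forall>k<n. transpose_mat (A ^\<^sub>m k * B) *\<^sub>v x = 0\<^sub>v m)"
proof -
  have AB: "A ^\<^sub>m k * B \<in> carrier_mat n m" for k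
    using A B by (rule mult_carrier_mat[OF pow_carrier_mat])
  have block: "col (reach_mat A B) j = col (A ^\<^sub>m (j div m) * B) (j mod m)" if "j < n * m" for j
  proof -
    have "j mod m < m"
      using that by (cases "m = 0") auto
    then show ?thesis
      using that A B by (intro eq_vecI) (auto simp: reach_mat_def Let_def)
  qed
  have "transpose_mat (reach_mat A B) *\<^sub>v x = 0\<^sub>v (n * m) \<longleftrightarrow>
      (\<forall>j<n * m. col (A ^\<^sub>m (j div m) * B) (j mod m) \<bullet> x = 0)"
    using reach_mat_carrier[OF A B] by (auto simp: vec_eq_iff block[symmetric])
  also have "\<dots> \<longleftrightarrow> (\<forall>k<n. \<forall>l<m. col (A ^\<^sub>m k * B) l \<bullet> x = 0)"
  proof (intro iffI allI impI)
    fix k l assume "\<forall>j<n * m. col (A ^\<^sub>m (j div m) * B) (j mod m) \<bullet> x = 0" and kl: "k < n" "l < m"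
    moreover have "k * m + l < n * m"
    proof -
      have "k * m + l < Suc k * m"
        using kl by simp
      also have "\<dots> \<le> n * m"
        using kl by (intro mult_le_mono1) simp
      finally show ?thesis .
    qed
    ultimately show "col (A ^\<^sub>m k * B) l \<bullet> x = 0"
      using kl by (fastforce dest: spec[of _ "k * m + l"])
  next
    fix j assume *: "\<forall>k<n. \<forall>l<m. col (A ^\<^sub>m k * B) l \<bullet> x = 0" and j: "j < n * m"
    then have "j div m < n" "j mod m < m"
      by (cases "m = 0"; auto simp: less_mult_imp_div_less)+
    with * show "col (A ^\<^sub>m (j div m) * B) (j mod m) \<bullet> x = 0"
      by blast
  qed
  also have "\<dots> \<longleftrightarrow> (\<forall>k<n. transpose_mat (A ^\<^sub>m k * B) *\<^sub>v x = 0\<^sub>v m)"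
    using carrier_matD[OF AB] by (auto simp: vec_eq_iff)
  finally show ?thesis .
qed

text \<open>By Cayley-Hamilton, the power n + j of A is a linear combination of the n powers from j
  on, so a vector that annihilates the first n blocks annihilates all later ones by strong
  induction.\<close>

lemma transpose_pow_mult_eq_0_all:
  fixes A B :: "'a :: field mat"
  assumes A: "A \<in> carrier_mat n n" and B: "B \<in> carrier_mat n m" and x: "x \<in> carrier_vec n"
    and less: "\<forall>k<n. transpose_mat (A ^\<^sub>m k * B) *\<^sub>v x = 0\<^sub>v m"
  shows "transpose_mat (A ^\<^sub>m k * B) *\<^sub>v x = 0\<^sub>v m"
proof (induction k rule: less_induct)
  case (less k)
  have AB: "A ^\<^sub>m k * B \<in> carrier_mat n m" for k
    using A B by (rule mult_carrier_mat[OF pow_carrier_mat])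
  have eq0_iff: "transpose_mat (A ^\<^sub>m k * B) *\<^sub>v x = 0\<^sub>v m \<longleftrightarrow> (\<forall>l<m. x \<bullet> col (A ^\<^sub>m k * B) l = 0)" for k
  proof -
    have "x \<bullet> col (A ^\<^sub>m k * B) l = col (A ^\<^sub>m k * B) l \<bullet> x" if "l < m" for l
      using col_carrier_vec[OF that AB] by (rule comm_scalar_prod[OF x])
    then show ?thesis
      using carrier_matD[OF AB[of k]] by (auto simp: vec_eq_iff)
  qed
  show ?case
  proof (cases "k < n")
    case True
    then show ?thesis
      using assms(4) by blast
  next
    case False
    define j where "j = k - n"
    have k: "k = n + j"
      using False by (simp add: j_def)
    have "x \<bullet> col (A ^\<^sub>m k * B) l = 0" if l: "l < m" for l
    proof -
      let ?v = "col (A ^\<^sub>m j * B) l"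
      have v: "?v \<in> carrier_vec n"
        using AB[of j] by (rule col_carrier_vec[OF l])
      have shift: "A ^\<^sub>m i *\<^sub>v ?v = col (A ^\<^sub>m (i + j) * B) l" for i
      proof -
        have "A ^\<^sub>m i *\<^sub>v ?v = col (A ^\<^sub>m i * (A ^\<^sub>m j * B)) l"
          using A by (subst col_mult2[OF _ AB l]) auto
        also have "A ^\<^sub>m i * (A ^\<^sub>m j * B) = A ^\<^sub>m (i + j) * B"
          using A B by (simp add: pow_mat_add[OF A] assoc_mult_mat[of _ n n _ n _ m])
        finally show ?thesis .
      qed
      have "x \<bullet> col (A ^\<^sub>m (i + j) * B) l = 0" if "i < n" for i
        using less[of "i + j"] that l unfolding k eq0_iff by auto
      \<comment> \<open>The terms of index below n vanish by the induction hypothesis. The one that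
        is left has coefficient 1, because the characteristic polynomial is monic.\<close>
      then have "coeff (char_poly A) n * (x \<bullet> col (A ^\<^sub>m (n + j) * B) l) = 0"
        using cayley_hamilton_bilinear[OF A x v]
        by (simp add: shift lessThan_Suc_atMost[symmetric])
      then show ?thesis
        using degree_monic_char_poly[OF A] by (simp add: k)
    qed
    then show ?thesis
      unfolding eq0_iff by blast
  qed
qed

text \<open>With the bound k < n removed, the condition on the powers no longer depends on the state
  dimension, so models of dimensions n and r can be compared.\<close>

lemma reachable_iff:
  assumes A: "A \<in> carrier_mat n n" and B: "B \<in> carrier_mat n m"
  shows "reachable A B \<longleftrightarrow>
    (\<forall>x \<in> carrier_vec n. (\<forall>k. transpose_mat (A ^\<^sub>m k * B) *\<^sub>v x = 0\<^sub>v m) \<longrightarrow> x = 0\<^sub>v n)"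
proof -
  have "reachable A B \<longleftrightarrow>
      (\<forall>x \<in> carrier_vec n. (\<forall>k<n. transpose_mat (A ^\<^sub>m k * B) *\<^sub>v x = 0\<^sub>v m) \<longrightarrow> x = 0\<^sub>v n)"
    using A rank_real_eq_iff_kernel_transpose[OF reach_mat_carrier[OF A B]]
      transpose_reach_mat_mult_eq_0_iff[OF A B]
    by (simp add: reachable_def)
  then show ?thesis
    using transpose_pow_mult_eq_0_all[OF A B] by blast
qed

lemma observable_iff_reachable_transpose:
  assumes "A \<in> carrier_mat n n"
  shows "observable A C \<longleftrightarrow> reachable (transpose_mat A) (transpose_mat C)"
  using assms by (simp add: observable_def reachable_def)

text \<open>Intertwining carries over to all powers. If x annihilates every block of the pair
  \<open>A'\<close>, \<open>S * B\<close>, then the transpose of S maps x to a vector that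
  annihilates every block of A, B, hence to zero. The right inverse R makes the transpose of S
  injective, so x is zero.\<close>

lemma reachable_intertwine:
  assumes A: "A \<in> carrier_mat n n" and B: "B \<in> carrier_mat n m" and A': "A' \<in> carrier_mat r r"
    and S: "S \<in> carrier_mat r n" and R: "R \<in> carrier_mat n r" and SR: "S * R = 1\<^sub>m r"
    and intertwine: "A' * S = S * A" and "reachable A B"
  shows "reachable A' (S * B)"
proof -
  have pow: "A' ^\<^sub>m k * S = S * A ^\<^sub>m k" for k
  proof (induction k)
    case (Suc k)
    have "A' ^\<^sub>m Suc k * S = A' ^\<^sub>m k * (S * A)"
      using A' S by (simp add: assoc_mult_mat[of _ r r _ r _ n] intertwine)
    also have "\<dots> = (S * A ^\<^sub>m k) * A"
      using A' S A by (simp flip: Suc add: assoc_mult_mat[of _ r r _ n _ n])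
    finally show ?case
      using S A by (simp add: assoc_mult_mat[of _ r n _ n _ n])
  qed (use A A' S in simp)
  have pow_mult: "A' ^\<^sub>m k * (S * B) = S * (A ^\<^sub>m k * B)" for k
    using A A' S B by (simp flip: assoc_mult_mat[of _ r r _ n _ m] assoc_mult_mat[of _ r n _ n _ m] add: pow)
  have "x = 0\<^sub>v r"
    if x: "x \<in> carrier_vec r" and 0: "\<forall>k. transpose_mat (A' ^\<^sub>m k * (S * B)) *\<^sub>v x = 0\<^sub>v m" for x
  proof -
    have y: "transpose_mat S *\<^sub>v x \<in> carrier_vec n"
      using S x by simp
    have "transpose_mat (A ^\<^sub>m k * B) *\<^sub>v (transpose_mat S *\<^sub>v x) = 0\<^sub>v m" for k
    proof -
      have AB: "A ^\<^sub>m k * B \<in> carrier_mat n m"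
        using A B by (rule mult_carrier_mat[OF pow_carrier_mat])
      have "transpose_mat (A ^\<^sub>m k * B) *\<^sub>v (transpose_mat S *\<^sub>v x) = transpose_mat (S * (A ^\<^sub>m k * B)) *\<^sub>v x"
        using S AB x
        by (subst transpose_mult[OF S AB], subst assoc_mult_mat_vec[of _ m n _ r]) auto
      then show ?thesis
        using 0 by (simp add: pow_mult)
    qed
    then have "transpose_mat S *\<^sub>v x = 0\<^sub>v n"
      using assms(8) y unfolding reachable_iff[OF A B] by blast
    then have "transpose_mat R *\<^sub>v (transpose_mat S *\<^sub>v x) = 0\<^sub>v r"
      using R by (auto intro!: eq_vecI simp: scalar_prod_right_zero[of _ n])
    moreover have "transpose_mat R *\<^sub>v (transpose_mat S *\<^sub>v x) = transpose_mat (S * R) *\<^sub>v x"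
      using R S x by (subst transpose_mult[OF S R], subst assoc_mult_mat_vec[of _ r n _ r]) auto
    ultimately show ?thesis
      using x by (simp add: SR)
  qed
  then show ?thesis
    using A' S B by (subst reachable_iff[of _ r _ m]) auto
qed

subsection \<open>Ordered eigenvalues and dominant invariant subspaces\<close>

lemma prod_list_linear_factors_neq_0:
  "(\<Prod>a\<leftarrow>xs. [:- a, 1:]) \<noteq> (0 :: 'a :: idom poly)"
  by (induction xs) (simp_all del: mult_pCons_left)

lemma ordered_eigvals_length:
  assumes M: "M \<in> carrier_mat n n" and lam: "ordered_eigvals M lam"
  shows "length lam = n"
proof -
  have "degree (\<Prod>a\<leftarrow>lam. [:- a, 1:]) = length lam"
    by (induction lam) (simp_all add: degree_mult_eq[OF _ prod_list_linear_factors_neq_0] del: mult_pCons_left)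
  then show ?thesis
    using degree_monic_char_poly[of "cmat M" n] M lam unfolding ordered_eigvals_def by simp
qed

lemma ordered_eigvals_transpose:
  assumes "M \<in> carrier_mat n n"
  shows "ordered_eigvals (transpose_mat M) lam \<longleftrightarrow> ordered_eigvals M lam"
  using assms char_poly_transpose_mat[of "cmat M" n]
  by (simp add: ordered_eigvals_def map_mat_transpose)

text \<open>The characteristic polynomial fixes the multiset of eigenvalues, and a multiset of
  moduli can be sorted in only one way. The lists themselves may differ where moduli tie, so lists
  from different sources are compared through their moduli. Reversal turns the decreasing order into
  the ascending one of \<open>sorted\<close>.\<close>

lemma ordered_eigvals_cmod_unique:
  assumes "ordered_eigvals M lam" "ordered_eigvals M mu"
  shows "map cmod lam = map cmod mu"
proof -
  have proots: "proots (\<Prod>a\<leftarrow>xs. [:- a, 1:]) = mset xs" for xs :: "complex list"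
    by (induction xs) (simp_all add: proots_mult[OF _ prod_list_linear_factors_neq_0] del: mult_pCons_left)
  have "mset lam = mset mu"
    using assms proots unfolding ordered_eigvals_def by metis
  then have "mset (rev (map cmod lam)) = mset (rev (map cmod mu))"
    by simp
  moreover have "sorted (rev (map cmod xs))" if "ordered_eigvals M xs" for xs
    using that by (simp add: ordered_eigvals_def sorted_wrt_rev sorted_wrt_map)
  ultimately have "rev (map cmod lam) = rev (map cmod mu)"
    using assms by (metis properties_for_sort)
  then show ?thesis
    by simp
qed

lemma ordered_eigvals_cmod_le:
  assumes "ordered_eigvals M lam" "i \<le> j" "j < length lam"
  shows "cmod (lam ! j) \<le> cmod (lam ! i)"
  using assms sorted_wrt_nth_less[of _ lam i j]
  unfolding ordered_eigvals_def by (cases "i = j") auto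

section \<open>Leading Jordan chain columns and invariance of the dominant subspace\<close>

definition leading_cols :: "nat \<Rightarrow> 'a mat \<Rightarrow> 'a mat" where
  "leading_cols r M = mat (dim_row M) r (\<lambda>(i, j). M $$ (i, j))"

lemma leading_cols_carrier:
  "M \<in> carrier_mat n m \<Longrightarrow> leading_cols r M \<in> carrier_mat n r"
  by (simp add: leading_cols_def)

lemma col_leading_cols:
  assumes "M \<in> carrier_mat n m" "r \<le> m" "j < r"
  shows "col (leading_cols r M) j = col M j"
  using assms by (intro eq_vecI) (auto simp: leading_cols_def)

text \<open>The zero rows of the right factor cancel all columns of M from index r on. This turns
  the factorization in \<open>U_d\<close> into a product of an n by r and an r by r matrix.\<close>

lemma mult_append_zero_rows:
  fixes M K :: "'a :: comm_semiring_0 mat"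
  assumes M: "M \<in> carrier_mat n n" and K: "K \<in> carrier_mat r c" and r: "r \<le> n"
  shows "M * (K @\<^sub>r 0\<^sub>m (n - r) c) = leading_cols r M * K"
proof (rule eq_matI)
  have KZ: "K @\<^sub>r 0\<^sub>m (n - r) c \<in> carrier_mat n c"
    using carrier_append_rows[OF K, of "0\<^sub>m (n - r) c" "n - r"] r by simp
  fix i j assume "i < dim_row (leading_cols r M * K)" "j < dim_col (leading_cols r M * K)"
  then have ij: "i < n" "j < c"
    using M K by (auto simp: leading_cols_def)
  have "(M * (K @\<^sub>r 0\<^sub>m (n - r) c)) $$ (i, j) = (\<Sum>k<n. M $$ (i, k) * (K @\<^sub>r 0\<^sub>m (n - r) c) $$ (k, j))"
    using M KZ ij by (simp add: scalar_prod_def atLeast0LessThan)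
  also have "\<dots> = (\<Sum>k<n. if k < r then M $$ (i, k) * K $$ (k, j) else 0)"
    using K ij r by (intro sum.cong) (auto simp: append_rows_def)
  also have "\<dots> = (\<Sum>k<r. M $$ (i, k) * K $$ (k, j))"
    using r by (intro sum.mono_neutral_cong_right) auto
  also have "\<dots> = (leading_cols r M * K) $$ (i, j)"
    using M K ij by (simp add: leading_cols_def scalar_prod_def atLeast0LessThan)
  finally show "(M * (K @\<^sub>r 0\<^sub>m (n - r) c)) $$ (i, j) = (leading_cols r M * K) $$ (i, j)" .
qed (use M K r in \<open>auto simp: leading_cols_def append_rows_def\<close>)

lemma stiefelD:
  assumes "X \<in> stiefel r n"
  shows "X \<in> carrier_mat n r" "transpose_mat X * X = 1\<^sub>m r"
  using assms by (auto simp: stiefel_def)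

lemma ordered_eigvec_matrixD:
  assumes M: "M \<in> carrier_mat n n" and Psi: "ordered_eigvec_matrix M lam Psi"
  shows "Psi \<in> carrier_mat n n" "invertible_mat Psi"
    and "j < n \<Longrightarrow> cmat M *\<^sub>v col Psi j = lam ! j \<cdot>\<^sub>v col Psi j \<or>
      0 < j \<and> lam ! (j - 1) = lam ! j \<and>
        (\<exists>c. cmat M *\<^sub>v col Psi j = lam ! j \<cdot>\<^sub>v col Psi j + c \<cdot>\<^sub>v col Psi (j - 1))"
  using Psi unfolding ordered_eigvec_matrix_def carrier_matD(1)[OF M] by blast+

lemma U_dE:
  assumes M: "M \<in> carrier_mat n n" and r: "r \<le> n" and X: "X \<in> U_d r M"
  obtains lam Psi K where "X \<in> stiefel r n" "ordered_eigvals M lam" "ordered_eigvec_matrix M lam Psi"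
    "K \<in> carrier_mat r r" "det K \<noteq> 0" "cmat X = leading_cols r Psi * K"
proof -
  obtain lam Psi K where *: "X \<in> stiefel r n" "ordered_eigvals M lam" "ordered_eigvec_matrix M lam Psi"
    "K \<in> carrier_mat r r" "vec_space.rank r K = r" "cmat X = Psi * (K @\<^sub>r 0\<^sub>m (n - r) r)"
    using X M unfolding U_d_def by auto
  moreover have "Psi \<in> carrier_mat n n"
    using ordered_eigvec_matrixD(1)[OF M *(3)] .
  ultimately show thesis
    using that vec_space.det_rank_iff[of K r] mult_append_zero_rows[of Psi n K r r] r by metis
qed

text \<open>Every column is mapped into the span of itself and its left neighbour, so an initial
  segment of the columns spans an invariant subspace. \<open>J\<close> is the matrix of the
  restriction to it.\<close>

lemma ordered_eigvec_matrix_leading_cols: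
  assumes M: "M \<in> carrier_mat n n" and Psi: "ordered_eigvec_matrix M lam Psi" and r: "r \<le> n"
  obtains J where "J \<in> carrier_mat r r" "cmat M * leading_cols r Psi = leading_cols r Psi * J"
proof -
  let ?P = "leading_cols r Psi"
  have Psi_carrier: "Psi \<in> carrier_mat n n"
    using ordered_eigvec_matrixD(1)[OF M Psi] .
  then have P: "?P \<in> carrier_mat n r"
    by (rule leading_cols_carrier)
  have "\<exists>v \<in> carrier_vec r. cmat M *\<^sub>v col ?P j = ?P *\<^sub>v v" if j: "j < r" for j
  proof -
    have e: "?P *\<^sub>v (a \<cdot>\<^sub>v unit_vec r i) = a \<cdot>\<^sub>v col ?P i" if "i < r" for a i
      using P that by (intro eq_vecI) (auto simp: scalar_prod_right_unit[of _ r])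
    have cols: "col ?P i = col Psi i" if "i < r" for i
      using col_leading_cols[OF Psi_carrier r that] .
    have "cmat M *\<^sub>v col Psi j = (lam ! j) \<cdot>\<^sub>v col Psi j \<or>
        0 < j \<and> (\<exists>c. cmat M *\<^sub>v col Psi j = (lam ! j) \<cdot>\<^sub>v col Psi j + c \<cdot>\<^sub>v col Psi (j - 1))"
      using ordered_eigvec_matrixD(3)[OF M Psi, of j] j r by auto
    then show ?thesis
    proof (elim disjE conjE exE)
      assume "cmat M *\<^sub>v col Psi j = (lam ! j) \<cdot>\<^sub>v col Psi j"
      then show ?thesis
        using j by (intro bexI[of _ "lam ! j \<cdot>\<^sub>v unit_vec r j"]) (auto simp: e cols)
    next
      fix c assume *: "0 < j" "cmat M *\<^sub>v col Psi j = (lam ! j) \<cdot>\<^sub>v col Psi j + c \<cdot>\<^sub>v col Psi (j - 1)"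
      have "?P *\<^sub>v (lam ! j \<cdot>\<^sub>v unit_vec r j + c \<cdot>\<^sub>v unit_vec r (j - 1)) =
          lam ! j \<cdot>\<^sub>v col ?P j + c \<cdot>\<^sub>v col ?P (j - 1)"
        using j by (subst mult_add_distrib_mat_vec[OF P]) (auto simp: e)
      then show ?thesis
        using j * by (intro bexI[of _ "lam ! j \<cdot>\<^sub>v unit_vec r j + c \<cdot>\<^sub>v unit_vec r (j - 1)"]) (auto simp: cols)
    qed
  qed
  then obtain v where v: "\<And>j. j < r \<Longrightarrow> v j \<in> carrier_vec r"
      "\<And>j. j < r \<Longrightarrow> cmat M *\<^sub>v col ?P j = ?P *\<^sub>v v j"
    by metis
  define J where "J = mat r r (\<lambda>(i, j). v j $ i)"
  have J: "J \<in> carrier_mat r r"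
    by (simp add: J_def)
  have colJ: "col J j = v j" if "j < r" for j
    using that v(1)[OF that] by (intro eq_vecI) (auto simp: J_def)
  have "cmat M * ?P = ?P * J"
  proof (rule mat_col_eqI)
    fix j assume "j < dim_col (?P * J)"
    then have j: "j < r"
      using J by simp
    show "col (cmat M * ?P) j = col (?P * J) j"
      using col_mult2[OF _ P j, of "cmat M" n] col_mult2[OF P J j] v(2)[OF j] M by (simp add: colJ j)
  qed (use M P J in auto)
  with J show thesis
    by (rule that)
qed

lemma cmat_mult:
  assumes "M \<in> carrier_mat nr n" "N \<in> carrier_mat n nc"
  shows "cmat (M * N) = cmat M * cmat N"
  using assms by (rule of_real_hom.mat_hom_mult)

lemma cmat_inject: "cmat M = cmat N \<longleftrightarrow> M = N"
  by (auto simp: mat_eq_iff)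

lemma U_d_invariant:
  assumes M: "M \<in> carrier_mat n n" and r: "r \<le> n" and X: "X \<in> U_d r M"
  shows "M * X = X * red_A X M"
proof -
  obtain lam Psi K where *: "X \<in> stiefel r n" "ordered_eigvec_matrix M lam Psi"
      "K \<in> carrier_mat r r" "det K \<noteq> 0" "cmat X = leading_cols r Psi * K"
    using U_dE[OF M r X] by metis
  let ?P = "leading_cols r Psi"
  note X' = stiefelD[OF *(1)]
  have P: "?P \<in> carrier_mat n r"
    using leading_cols_carrier[OF ordered_eigvec_matrixD(1)[OF M *(2)]] .
  obtain J where J: "J \<in> carrier_mat r r" "cmat M * ?P = ?P * J"
    using ordered_eigvec_matrix_leading_cols[OF M *(2) r] .
  have Ki: "minv K \<in> carrier_mat r r" "K * minv K = 1\<^sub>m r"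
    using inverts_mat_minv[OF *(3)] invertible_mat_iff_det[OF *(3)] *(4) by auto
  \<comment> \<open>The restriction of M, expressed in the basis formed by the columns of X; K is
    the change of basis.\<close>
  define L where "L = minv K * J * K"
  have L: "L \<in> carrier_mat r r"
    using Ki J *(3) by (simp add: L_def)
  have "cmat X * L = ?P * ((K * minv K) * (J * K))"
    using P *(3) Ki(1) J(1) by (simp add: *(5) L_def assoc_mult_mat[of _ n r _ r _ r] assoc_mult_mat[of _ r r _ r _ r])
  also have "\<dots> = (?P * J) * K"
    using P *(3) J(1) by (simp add: Ki(2) left_mult_one_mat[of _ r r] assoc_mult_mat[of _ n r _ r _ r])
  also have "\<dots> = cmat M * cmat X"
    using M P *(3) by (simp flip: J(2) add: *(5) assoc_mult_mat[of _ n n _ r _ r] del: assoc_mult_mat)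
  finally have MX: "cmat M * cmat X = cmat X * L" by simp
  \<comment> \<open>Since the columns of X are orthonormal, multiplying by the transpose of X
    identifies the complex matrix \<open>L\<close> with the real matrix \<open>red_A X M\<close>, so
    the invariance identity descends to the reals.\<close>
  have "cmat (red_A X M) = cmat (transpose_mat X) * (cmat M * cmat X)"
    using M X' by (simp add: red_A_def cmat_mult[of _ r n _ r] cmat_mult[of _ n n _ r])
  also have "\<dots> = cmat (transpose_mat X * X) * L"
    unfolding MX using X'(1) L
    by (simp add: cmat_mult[of _ r n _ r] assoc_mult_mat[of _ r n _ r _ r])
  also have "\<dots> = L"
    using L X'(2) by (simp add: of_real_hom.mat_hom_one)
  finally have "cmat (M * X) = cmat (X * red_A X M)"
    using M X' by (simp add: red_A_def cmat_mult[of _ n n _ r] cmat_mult[of _ n r _ r] MX)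
  then show ?thesis
    unfolding cmat_inject .
qed

subsection \<open>Pairing of the left and right dominant subspaces\<close>

text \<open>The pairing \<bullet> is bilinear, without conjugation, so A moves across it as its
  transpose. Evaluated from either side, the chain predecessors contribute pairings of smaller i +
  j, which vanish by induction. What remains says that \<open>mu ! i\<close> and
  \<open>lam ! j\<close> give the same multiple of the pairing.\<close>

lemma eigvec_chains_orthogonal:
  assumes A: "A \<in> carrier_mat n n"
    and Psi: "ordered_eigvec_matrix A lam Psi"
    and Phi: "ordered_eigvec_matrix (transpose_mat A) mu Phi"
    and gap: "lam ! (r - 1) \<noteq> lam ! r"
    and disj: "\<And>i j. i < r \<Longrightarrow> r \<le> j \<Longrightarrow> j < n \<Longrightarrow> mu ! i \<noteq> lam ! j"
    and ij: "i < r" "r \<le> j" "j < n"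
  shows "col Phi i \<bullet> col Psi j = 0"
  using ij
proof (induction "i + j" arbitrary: i j rule: less_induct)
  case less
  let ?x = "col Phi i" and ?y = "col Psi j"
  have At: "transpose_mat A \<in> carrier_mat n n"
    using A by simp
  have carrier: "Psi \<in> carrier_mat n n" "Phi \<in> carrier_mat n n"
    using ordered_eigvec_matrixD(1)[OF A Psi] ordered_eigvec_matrixD(1)[OF At Phi] .
  have cols: "col Phi k \<in> carrier_vec n" "col Psi k \<in> carrier_vec n" for k
    using carrier by (auto intro!: carrier_vecI)
  have cA: "cmat A \<in> carrier_mat n n"
    using A by simp
  have left: "(cmat (transpose_mat A) *\<^sub>v ?x) \<bullet> ?y = mu ! i * (?x \<bullet> ?y)"
  proof -
    have "cmat (transpose_mat A) *\<^sub>v ?x = mu ! i \<cdot>\<^sub>v ?x \<or>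
        0 < i \<and> (\<exists>c. cmat (transpose_mat A) *\<^sub>v ?x = mu ! i \<cdot>\<^sub>v ?x + c \<cdot>\<^sub>v col Phi (i - 1))"
      using ordered_eigvec_matrixD(3)[OF At Phi, of i] less.prems by auto
    then show ?thesis
    proof (elim disjE conjE exE)
      fix c assume i: "0 < i" and c: "cmat (transpose_mat A) *\<^sub>v ?x = mu ! i \<cdot>\<^sub>v ?x + c \<cdot>\<^sub>v col Phi (i - 1)"
      have "col Phi (i - 1) \<bullet> ?y = 0"
        using less.hyps[of "i - 1" j] less.prems i by simp
      then show ?thesis
        unfolding c using cols[of i] cols[of j] cols[of "i - 1"]
        by (simp add: add_scalar_prod_distrib[of _ n])
    qed (use cols[of i] cols[of j] in simp)
  qed
  have right: "?x \<bullet> (cmat A *\<^sub>v ?y) = lam ! j * (?x \<bullet> ?y)"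
  proof -
    have "cmat A *\<^sub>v ?y = lam ! j \<cdot>\<^sub>v ?y \<or>
        0 < j \<and> lam ! (j - 1) = lam ! j \<and> (\<exists>c. cmat A *\<^sub>v ?y = lam ! j \<cdot>\<^sub>v ?y + c \<cdot>\<^sub>v col Psi (j - 1))"
      using ordered_eigvec_matrixD(3)[OF A Psi, of j] less.prems by auto
    then show ?thesis
    proof (elim disjE conjE exE)
      fix c assume j: "0 < j" "lam ! (j - 1) = lam ! j"
        and c: "cmat A *\<^sub>v ?y = lam ! j \<cdot>\<^sub>v ?y + c \<cdot>\<^sub>v col Psi (j - 1)"
      txt \<open>By the gap, no Jordan chain crosses from column \<open>r - 1\<close> to column \<open>r\<close>.\<close>
      have "j \<noteq> r"
        using j gap by auto
      then have "?x \<bullet> col Psi (j - 1) = 0"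
        using less.hyps[of i "j - 1"] less.prems by simp
      then show ?thesis
        unfolding c using cols[of i] cols[of j] cols[of "j - 1"]
        by (simp add: scalar_prod_add_distrib[of _ n])
    qed (use cols[of i] cols[of j] in simp)
  qed
  have "mu ! i * (?x \<bullet> ?y) = lam ! j * (?x \<bullet> ?y)"
    using transpose_vec_mult_scalar[OF cA cols(2) cols(1), of i j] left right
    by (simp add: map_mat_transpose)
  then show ?case
    using disj[OF less.prems] by simp
qed

text \<open>Orthogonality makes the upper right block of \<open>transpose_mat Phi * Psi\<close>
  vanish, so the nonzero determinant of this product is the determinant of the leading block times
  another factor.\<close>

lemma det_leading_cols_pairing:
  fixes Phi Psi :: "'a :: field mat"
  assumes Phi: "Phi \<in> carrier_mat n n" "invertible_mat Phi"
    and Psi: "Psi \<in> carrier_mat n n" "invertible_mat Psi"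
    and r: "r \<le> n"
    and orth: "\<And>i j. i < r \<Longrightarrow> r \<le> j \<Longrightarrow> j < n \<Longrightarrow> col Phi i \<bullet> col Psi j = 0"
  shows "det (transpose_mat (leading_cols r Phi) * leading_cols r Psi) \<noteq> 0"
proof -
  let ?G = "transpose_mat Phi * Psi"
  define G11 where "G11 = transpose_mat (leading_cols r Phi) * leading_cols r Psi"
  define G21 where "G21 = mat (n - r) r (\<lambda>(i, j). ?G $$ (i + r, j))"
  define G22 where "G22 = mat (n - r) (n - r) (\<lambda>(i, j). ?G $$ (i + r, j + r))"
  have G11: "G11 \<in> carrier_mat r r"
    unfolding G11_def using Phi Psi leading_cols_carrier by (intro mult_carrier_mat[of _ r n]) auto
  have G11_index: "G11 $$ (i, j) = col Phi i \<bullet> col Psi j" if "i < r" "j < r" for i j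
    using that leading_cols_carrier[OF Phi(1), of r] leading_cols_carrier[OF Psi(1), of r]
      col_leading_cols[OF Phi(1) r] col_leading_cols[OF Psi(1) r] by (simp add: G11_def)
  have "?G = four_block_mat G11 (0\<^sub>m r (n - r)) G21 G22"
    using r Phi(1) Psi(1) G11 G11_index orth
    by (intro eq_matI) (auto simp: G21_def G22_def)
  then have "det ?G = det G11 * det G22"
    using det_four_block_mat_upper_right_zero[OF G11 refl, of G21 "n - r" G22]
    by (simp add: G21_def G22_def)
  moreover have "det ?G \<noteq> 0"
    using Phi Psi invertible_mat_iff_det[OF Phi(1)] invertible_mat_iff_det[OF Psi(1)]
      det_mult[of "transpose_mat Phi" n Psi] det_transpose[OF Phi(1)] by simp
  ultimately show ?thesis
    unfolding G11_def by auto
qed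

text \<open>Membership of U and V in their sets supplies separate eigenvalue lists \<open>al\<close>
  and \<open>mu\<close>. Both have the moduli of \<open>lam\<close>, which transfers the gap to them
  and makes the chains orthogonal.\<close>

lemma U_d_pairing_invertible:
  assumes A: "A \<in> carrier_mat n n" and r: "1 \<le> r" "r < n"
    and lam: "ordered_eigvals A lam" and gap: "cmod (lam ! r) < cmod (lam ! (r - 1))"
    and U: "U \<in> U_d r A" and V: "V \<in> U_d r (transpose_mat A)"
  shows "invertible_mat (transpose_mat V * U)"
proof -
  have At: "transpose_mat A \<in> carrier_mat n n" and rn: "r \<le> n"
    using A r by simp_all
  obtain al Psi K where U': "U \<in> stiefel r n" "ordered_eigvals A al" "ordered_eigvec_matrix A al Psi"
      "K \<in> carrier_mat r r" "det K \<noteq> 0" "cmat U = leading_cols r Psi * K"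
    using U_dE[OF A rn U] .
  obtain mu Phi L where V': "V \<in> stiefel r n" "ordered_eigvals (transpose_mat A) mu"
      "ordered_eigvec_matrix (transpose_mat A) mu Phi"
      "L \<in> carrier_mat r r" "det L \<noteq> 0" "cmat V = leading_cols r Phi * L"
    using U_dE[OF At rn V] .
  have mu: "ordered_eigvals A mu"
    using V'(2) ordered_eigvals_transpose[OF A] by simp
  have len: "length lam = n" "length al = n" "length mu = n"
    using ordered_eigvals_length[OF A] lam U'(2) mu by auto
  have cmod_al: "cmod (al ! i) = cmod (lam ! i)" and cmod_mu: "cmod (mu ! i) = cmod (lam ! i)" if "i < n" for i
    using arg_cong[OF ordered_eigvals_cmod_unique[OF U'(2) lam], of "\<lambda>xs. xs ! i"]
      arg_cong[OF ordered_eigvals_cmod_unique[OF mu lam], of "\<lambda>xs. xs ! i"] len that by simp_all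
  have "al ! (r - 1) \<noteq> al ! r"
    using gap cmod_al[of "r - 1"] cmod_al[of r] r by (auto simp: less_imp_diff_less)
  moreover have "mu ! i \<noteq> al ! j" if "i < r" "r \<le> j" "j < n" for i j
  proof -
    have "cmod (al ! j) \<le> cmod (lam ! r)"
      using ordered_eigvals_cmod_le[OF lam, of r j] that len cmod_al[of j] by simp
    also note gap
    also have "cmod (lam ! (r - 1)) \<le> cmod (mu ! i)"
      using ordered_eigvals_cmod_le[OF lam, of i "r - 1"] that len cmod_mu[of i] r by simp
    finally show ?thesis
      by auto
  qed
  ultimately have "col Phi i \<bullet> col Psi j = 0" if "i < r" "r \<le> j" "j < n" for i j
    using eigvec_chains_orthogonal[OF A U'(3) V'(3)] that by blast
  moreover have Phi: "Phi \<in> carrier_mat n n" "invertible_mat Phi" and Psi: "Psi \<in> carrier_mat n n" "invertible_mat Psi"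
    using ordered_eigvec_matrixD[OF A U'(3)] ordered_eigvec_matrixD[OF At V'(3)] by auto
  ultimately have G: "det (transpose_mat (leading_cols r Phi) * leading_cols r Psi) \<noteq> 0" (is "det ?G \<noteq> 0")
    using det_leading_cols_pairing[OF Phi Psi rn] by blast
  note P = leading_cols_carrier[OF Phi(1), of r] leading_cols_carrier[OF Psi(1), of r]
  have Gc: "?G \<in> carrier_mat r r"
    using P by (intro mult_carrier_mat[of _ r n]) auto
  have T: "transpose_mat V * U \<in> carrier_mat r r"
    using stiefelD[OF U'(1)] stiefelD[OF V'(1)] by simp
  \<comment> \<open>The pairing of U and V differs from that of the leading chain columns only by
    the invertible coordinate matrices K and L, and complexification preserves determinants.\<close>
  have "cmat (transpose_mat V * U) = transpose_mat (leading_cols r Phi * L) * (leading_cols r Psi * K)"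
    using stiefelD[OF U'(1)] stiefelD[OF V'(1)]
    by (simp add: cmat_mult[of _ r n _ r] map_mat_transpose[symmetric] U'(6) V'(6))
  also have "\<dots> = transpose_mat L * ?G * K"
    using P U'(4) V'(4)
    by (simp add: transpose_mult[OF P(1) V'(4)] assoc_mult_mat[of _ r r _ r _ r] assoc_mult_mat[of _ r n _ r _ r]
        assoc_mult_mat[of _ r r _ n _ r])
  finally have "det (cmat (transpose_mat V * U)) = det L * det ?G * det K"
    using U'(4) V'(4) Gc by (simp add: det_mult[of _ r] det_transpose)
  then have "det (transpose_mat V * U) \<noteq> 0"
    using G U'(5) V'(5) by (auto simp: of_real_hom.hom_det)
  then show ?thesis
    using invertible_mat_iff_det[OF T] by simp
qed

subsection \<open>The reduced models\<close>

text \<open>The similarity T also intertwines the pencils, so the inverse of the second is that of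
  the first conjugated by T. The factors \<open>S * T\<close> next to the input and output matrices
  then cancel.\<close>

lemma transfer_fun_similar:
  assumes carrier: "A1 \<in> carrier_mat r r" "A2 \<in> carrier_mat r r" "B \<in> carrier_mat r m" "C \<in> carrier_mat p r"
    and T: "T \<in> carrier_mat r r" "S \<in> carrier_mat r r" "T * S = 1\<^sub>m r" "S * T = 1\<^sub>m r"
    and sim: "A2 * T = T * A1" and inv: "invertible_mat (pencil A1 z)"
  shows "transfer_fun A1 (S * B) C z = transfer_fun A2 B (C * S) z"
proof -
  let ?P1 = "pencil A1 z" and ?P2 = "pencil A2 z"
  have P: "?P1 \<in> carrier_mat r r" "?P2 \<in> carrier_mat r r"
    using carrier by (auto simp: pencil_def)
  note N = inverts_mat_minv[OF P(1) inv]
  have cT: "cmat T \<in> carrier_mat r r" and cS: "cmat S \<in> carrier_mat r r"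
    using T by auto
  have TS: "cmat T * cmat S = 1\<^sub>m r" "cmat S * cmat T = 1\<^sub>m r"
    using T by (simp_all flip: cmat_mult[of _ r r _ r] add: of_real_hom.mat_hom_one)
  have "cmat A2 * cmat T = cmat T * cmat A1"
    using T carrier sim by (simp flip: cmat_mult[of _ r r _ r])
  then have PT: "?P2 * cmat T = cmat T * ?P1"
    using cT carrier
    by (simp add: pencil_def minus_mult_distrib_mat[of _ r r _ _ r] mult_minus_distrib_mat[of _ r r _ r]
        mult_smult_distrib[of _ r r _ r] mult_smult_assoc_mat[of _ r r _ r])
  have "?P2 * (cmat T * minv ?P1 * cmat S) = (?P2 * cmat T) * (minv ?P1 * cmat S)"
    using P cT cS N(1) by (simp add: assoc_mult_mat[of _ r r _ r _ r])
  also have "\<dots> = cmat T * ((?P1 * minv ?P1) * cmat S)"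
    unfolding PT using P cT cS N(1) by (simp add: assoc_mult_mat[of _ r r _ r _ r])
  also have "\<dots> = 1\<^sub>m r"
    using cS by (simp add: N(2) TS(1))
  finally have "minv ?P2 = cmat T * minv ?P1 * cmat S"
    using P(2) cT cS N(1) by (intro minv_eqI[of _ r]) auto
  then have "transfer_fun A2 B (C * S) z = cmat (C * S) * (cmat T * minv ?P1 * cmat S) * cmat B"
    by (simp add: transfer_fun_def)
  also have "\<dots> = cmat C * ((cmat S * cmat T) * (minv ?P1 * (cmat S * cmat B)))"
    using carrier T(2) cT cS N(1)
    by (simp add: cmat_mult[of _ p r _ r] assoc_mult_mat[of _ p r _ r _ r] assoc_mult_mat[of _ p r _ r _ m]
        assoc_mult_mat[of _ r r _ r _ r] assoc_mult_mat[of _ r r _ r _ m])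
  also have "\<dots> = cmat C * minv ?P1 * cmat (S * B)"
    using carrier T(2) cT cS N(1)
    by (simp add: TS(2) cmat_mult[of _ r r _ m] left_mult_one_mat[of _ r m] assoc_mult_mat[of _ p r _ r _ m])
  finally show ?thesis
    by (simp add: transfer_fun_def)
qed

theorem proposition7:
  fixes A B C U V :: "real mat" and lam :: "complex list" and n m p r :: nat
  assumes "A \<in> carrier_mat n n" and "B \<in> carrier_mat n m" and "C \<in> carrier_mat p n"
    and "1 \<le> r" and "r \<le> n - 1"
    and "ordered_eigvals A lam" and "cmod (lam ! (r - 1)) > cmod (lam ! r)"
    and "reachable A B" and "observable A C"
    and "U \<in> U_d r A" and "V \<in> U_d r (transpose_mat A)"
  defines "T \<equiv> transpose_mat V * U"
  defines "A1 \<equiv> red_A U A" and "B1 \<equiv> red_B (V * transpose_mat (minv T)) B" and "C1 \<equiv> red_C U C"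
  defines "A2 \<equiv> red_A V A" and "B2 \<equiv> red_B V B" and "C2 \<equiv> red_C (U * minv T) C"
  shows "invertible_mat T
    \<and> observable A1 C1 \<and> reachable A1 B1
    \<and> observable A2 C2 \<and> reachable A2 B2
    \<and> (\<forall>z. invertible_mat (pencil A1 z) \<and> invertible_mat (pencil A2 z) \<longrightarrow>
           transfer_fun A1 B1 C1 z = transfer_fun A2 B2 C2 z)"
proof -
  note A = assms(1) and B = assms(2) and C = assms(3)
  have At: "transpose_mat A \<in> carrier_mat n n" and rn: "r \<le> n" "r < n"
    using A assms(4,5) by auto
  have U: "U \<in> carrier_mat n r" "transpose_mat U * U = 1\<^sub>m r"
    and V: "V \<in> carrier_mat n r" "transpose_mat V * V = 1\<^sub>m r"
    using U_dE[OF A rn(1) assms(10)] U_dE[OF At rn(1) assms(11)] stiefelD by metis+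
  have Ut: "transpose_mat U \<in> carrier_mat r n" and Vt: "transpose_mat V \<in> carrier_mat r n"
    using U V by simp_all
  have T: "T \<in> carrier_mat r r"
    unfolding T_def using U V by simp
  have invT: "invertible_mat T"
    unfolding T_def using U_d_pairing_invertible[OF A assms(4) rn(2) assms(6,7,10,11)] .
  define S where "S = minv T"
  have S: "S \<in> carrier_mat r r" "T * S = 1\<^sub>m r" "S * T = 1\<^sub>m r"
    unfolding S_def using inverts_mat_minv[OF T invT] by auto
  have A1: "A1 \<in> carrier_mat r r" and A2: "A2 \<in> carrier_mat r r"
    unfolding A1_def A2_def red_A_def using A U V by auto
  have B2_eq: "B2 = transpose_mat V * B" and C1_eq: "C1 = C * U"
    by (simp_all add: B2_def C1_def red_B_def red_C_def)
  \<comment> \<open>Each of \<open>B1\<close> and \<open>C2\<close> is needed in two forms: as a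
    similarity transform of the other reduced model, for the transfer functions, and as a
    compression of B or C, for reachability and observability.\<close>
  have B1_eq: "B1 = S * B2" "B1 = (S * transpose_mat V) * B"
    using S V B transpose_mult[OF V(1), of "transpose_mat S" r]
    by (simp_all add: B1_def B2_eq red_B_def flip: S_def assoc_mult_mat[of _ r r _ n _ m] del: assoc_mult_mat)
  have C2_eq: "C2 = C1 * S" "C2 = C * (U * S)"
    using S U C by (simp_all add: C2_def C1_eq red_C_def flip: S_def)
  have AU: "A * U = U * A1"
    unfolding A1_def using U_d_invariant[OF A rn(1) assms(10)] .
  \<comment> \<open>Invariance of V under the transpose of A; transposed again, it makes
    \<open>transpose_mat V\<close> intertwine A with \<open>A2\<close>.\<close>
  have "transpose_mat A * V = V * transpose_mat A2"
  proof -
    have "red_A V (transpose_mat A) = transpose_mat A2"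
      unfolding red_A_def A2_def using A V
      by (simp add: transpose_mult[of _ r n _ r] transpose_mult[of _ n n _ r])
    then show ?thesis
      using U_d_invariant[OF At rn(1) assms(11)] by simp
  qed
  from arg_cong[OF this, of transpose_mat] have VA: "transpose_mat V * A = A2 * transpose_mat V"
    using transpose_mult[OF At V(1)] transpose_mult[OF V(1), of "transpose_mat A2" r] A2 by simp
  have A2T: "A2 * T = T * A1"
  proof -
    have "A2 * T = (A2 * transpose_mat V) * U"
      unfolding T_def using A2 Vt U(1) by simp
    also have "\<dots> = transpose_mat V * (U * A1)"
      unfolding VA[symmetric] AU[symmetric] using A Vt U(1) by simp
    also have "\<dots> = T * A1"
      unfolding T_def using A1 Vt U(1) by simp
    finally show ?thesis .
  qed
  have A1S: "A1 * S = S * A2"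
  proof -
    have "S * A2 = (S * A2) * (T * S)"
      using S A2 by simp
    also have "\<dots> = S * (A2 * T) * S"
      using S(1) A2 T by (simp add: assoc_mult_mat[of _ r r _ r _ r])
    also have "\<dots> = (S * T) * (A1 * S)"
      unfolding A2T using S(1) A1 T by (simp add: assoc_mult_mat[of _ r r _ r _ r])
    finally show ?thesis
      using S A1 by simp
  qed
  have obs: "reachable (transpose_mat A) (transpose_mat C)"
    using assms(9) observable_iff_reachable_transpose[OF A] by simp
  have Ct: "transpose_mat C \<in> carrier_mat n p"
    using C by simp
  \<comment> \<open>The four claims use these intertwiners, each with its right inverse:
    \<open>transpose_mat V\<close> with V, \<open>S * transpose_mat V\<close> with U,
    \<open>transpose_mat U\<close> with U, and the transpose of \<open>U * S\<close> with V. The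
    last two act on the dual system.\<close>
  have "reachable A2 B2"
    unfolding B2_eq using reachable_intertwine[OF A B A2 Vt V VA[symmetric] assms(8)] .
  moreover have "reachable A1 B1"
    unfolding B1_eq(2)
  proof (rule reachable_intertwine[OF A B A1 _ U(1) _ _ assms(8)])
    show "S * transpose_mat V * U = 1\<^sub>m r"
      using S Vt U(1) by (simp flip: T_def)
    have "A1 * (S * transpose_mat V) = S * (A2 * transpose_mat V)"
      using A1 A2 S(1) Vt by (simp flip: assoc_mult_mat[of _ r r _ r _ n] add: A1S del: assoc_mult_mat)
    then show "A1 * (S * transpose_mat V) = S * transpose_mat V * A"
      using S(1) Vt A by (simp add: VA[symmetric])
  qed (use S Vt in simp)
  moreover have "observable A1 C1"
  proof -
    have "transpose_mat A1 * transpose_mat U = transpose_mat U * transpose_mat A"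
      using arg_cong[OF AU, of transpose_mat] transpose_mult[OF A U(1)] transpose_mult[OF U(1) A1] by simp
    from reachable_intertwine[OF At Ct _ Ut U this obs] show ?thesis
      unfolding observable_iff_reachable_transpose[OF A1] C1_eq transpose_mult[OF C U(1)] using A1 by simp
  qed
  moreover have "observable A2 C2"
  proof -
    let ?W = "U * S"
    have W: "?W \<in> carrier_mat n r"
      using U(1) S(1) by simp
    have "A * ?W = U * (A1 * S)"
      using A U(1) S(1) A1 by (simp flip: assoc_mult_mat[of _ n n _ r _ r] assoc_mult_mat[of _ n r _ r _ r] add: AU del: assoc_mult_mat)
    also have "\<dots> = ?W * A2"
      unfolding A1S using U(1) S(1) A2 by (simp add: assoc_mult_mat[of _ n r _ r _ r])
    finally have "transpose_mat A2 * transpose_mat ?W = transpose_mat ?W * transpose_mat A"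
      using transpose_mult[OF A W] transpose_mult[OF W A2] by simp
    moreover have "transpose_mat ?W * V = 1\<^sub>m r"
    proof -
      have "transpose_mat V * ?W = 1\<^sub>m r"
        using Vt U(1) S by (simp flip: assoc_mult_mat[of _ r n _ r _ r] add: T_def del: assoc_mult_mat)
      then show ?thesis
        using transpose_mult[OF Vt W] by simp
    qed
    ultimately show ?thesis
      using reachable_intertwine[OF At Ct _ _ V(1) _ _ obs, of "transpose_mat A2" "transpose_mat ?W"] A2 W
      unfolding observable_iff_reachable_transpose[OF A2] C2_eq(2) transpose_mult[OF C W] by simp
  qed
  moreover have "transfer_fun A1 B1 C1 z = transfer_fun A2 B2 C2 z" if "invertible_mat (pencil A1 z)" for z
    unfolding B1_eq(1) C2_eq(1)
    using transfer_fun_similar[OF A1 A2 _ _ T S A2T that, of B2 m C1 p] Vt B C U(1)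
    by (simp add: B2_eq C1_eq)
  ultimately show ?thesis
    using invT by blast
qed

end
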